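(* A game $G$ is tame if and only if it is $t$-miserable.
   Context: A game is a two-player impartial game given by a directed acyclic graph whose vertices are positions and whose arcs are moves, such that from every position only finitely many positions are reachable. A position with no moves is terminal. $\operatorname{mex}(S)$ is the least non-negative integer not in $S$. The normal Sprague–Grundy function is $\mathcal{G}(x)=\operatorname{mex}\{\mathcal{G}(y): x\to y\}$ (so $0$ on terminal positions); the misère Sprague–Grundy function $\mathcal{G}^-$ satisfies $\mathcal{G}^-(x)=1$ for terminal $x$ and $\mathcal{G}^-(x)=\operatorname{mex}\{\mathcal{G}^-(y): x\to y\}$ otherwise. An $(i,j)$-position is a position $x$ with $\mathcal{G}(x)=i$, $\mathcal{G}^-(x)=j$; $V_{i,j}$ denotes the set of $(i,j)$-positions. A position $x$ is movable to a set $W$ if there is a move from $x$ to some position of $W$. A game is tame if every position is a $(0,1)$-position, a $(1,0)$-position, or a $(k,k)$-position for some $k\ge 0$. A game is $t$-miserable if every position $x$ satisfies at least one of: (a$_0$) $x\in V_{0,1}\cup V_{1,0}\cup V_{0,0}\cup V_{1,1}$; (c) $x$ is movable to $V_{0,1}$ and to $V_{1,0}$; (e) $x$ is movable to $V_{0,0}$ and to $V_{1,1}$. *)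

theory Defs
  imports Main
begin

definition mex :: "nat set \<Rightarrow> nat" where
  "mex S = (LEAST n. n \<notin> S)"

text \<open>
  A game is a directed graph with an explicit vertex set \<open>P\<close> (the positions), so that positions need
  not exhaust a type, and arc set \<open>E\<close>; \<open>(x, y) \<in> E\<close> is the move from \<open>x\<close> to \<open>y\<close>.
\<close>

locale game =
  fixes P :: "'a set" and E :: "'a rel"
  assumes moves_in: "E \<subseteq> P \<times> P"
    and acyclic_moves: "acyclic E"
    and finite_reachable: "x \<in> P \<Longrightarrow> finite (E\<^sup>* `` {x})"
begin

lemma wf_converse_moves: "wf (E\<inverse>)"
proof (rule wfI_min)
  fix x :: 'a and Q assume xQ: "x \<in> Q"
  show "\<exists>z\<in>Q. \<forall>y. (y, z) \<in> E\<inverse> \<longrightarrow> y \<notin> Q"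
  proof (cases "x \<in> P")
    case False
    then show ?thesis using xQ moves_in by blast
  next
    case True
    define A where "A = E\<^sup>* `` {x}"
    define R where "R = E \<inter> A \<times> A"
    have "finite R"
      using finite_reachable[OF True] by (simp add: R_def A_def)
    moreover have "acyclic R"
      using acyclic_moves by (rule acyclic_subset) (simp add: R_def)
    ultimately have "wf (R\<inverse>)"
      by (rule finite_acyclic_wf_converse)
    moreover have "x \<in> Q \<inter> A" using xQ by (simp add: A_def)
    ultimately obtain z where z: "z \<in> Q \<inter> A" "\<And>y. (y, z) \<in> R\<inverse> \<Longrightarrow> y \<notin> Q \<inter> A"
      by (rule wfE_min) blast
    have "y \<notin> Q" if "(y, z) \<in> E\<inverse>" for y
    proof -
      have "y \<in> A" using that z(1) by (auto simp: A_def intro: rtrancl_into_rtrancl)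
      then show ?thesis using that z by (auto simp: R_def)
    qed
    then show ?thesis using z(1) by blast
  qed
qed

definition terminal :: "'a \<Rightarrow> bool" where
  "terminal x \<longleftrightarrow> E `` {x} = {}"

function sg :: "'a \<Rightarrow> nat" where
  "sg x = mex (sg ` (E `` {x}))"
  by auto
termination
  by (relation "E\<inverse>") (auto intro: wf_converse_moves)

function misere_sg :: "'a \<Rightarrow> nat" where
  "misere_sg x = (if terminal x then 1 else mex (misere_sg ` (E `` {x})))"
  by auto
termination
  by (relation "E\<inverse>") (auto intro: wf_converse_moves)

declare sg.simps [simp del] misere_sg.simps [simp del]

definition V :: "nat \<Rightarrow> nat \<Rightarrow> 'a set" where
  "V i j = {x \<in> P. sg x = i \<and> misere_sg x = j}"

definition movable :: "'a \<Rightarrow> 'a set \<Rightarrow> bool" where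
  "movable x W \<longleftrightarrow> (\<exists>y\<in>W. (x, y) \<in> E)"

definition tame :: bool where
  "tame \<longleftrightarrow> (\<forall>x\<in>P. x \<in> V 0 1 \<or> x \<in> V 1 0 \<or> (\<exists>k. x \<in> V k k))"

definition t_miserable :: bool where
  "t_miserable \<longleftrightarrow> (\<forall>x\<in>P.
     x \<in> V 0 1 \<union> V 1 0 \<union> V 0 0 \<union> V 1 1 \<or>
     (movable x (V 0 1) \<and> movable x (V 1 0)) \<or>
     (movable x (V 0 0) \<and> movable x (V 1 1)))"

end

end

theory Submission
  imports Defs
begin

lemma less_mex_imp_mem: "n < mex S \<Longrightarrow> n \<in> S"
  unfolding mex_def using not_less_Least by blast

context game
begin

text \<open>The pointwise form of \<open>tame\<close>, so that an induction along moves can assume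
  tameness of the options of a single position.\<close>

definition tame_at :: "'a \<Rightarrow> bool" where
  "tame_at x \<longleftrightarrow> x \<in> V 0 1 \<or> x \<in> V 1 0 \<or> (\<exists>k. x \<in> V k k)"

lemma tame_at_cases:
  assumes "tame_at x"
  obtains "sg x = 0" "misere_sg x = 1" | "sg x = 1" "misere_sg x = 0" | "sg x = misere_sg x"
  using assms unfolding tame_at_def V_def by auto

lemma V_iff: "(x, y) \<in> E \<Longrightarrow> y \<in> V i j \<longleftrightarrow> sg y = i \<and> misere_sg y = j"
  using moves_in unfolding V_def by auto

lemma misere_sg_nonterminal: "(x, y) \<in> E \<Longrightarrow> misere_sg x = mex (misere_sg ` (E `` {x}))"
  by (subst misere_sg.simps) (auto simp: terminal_def)

text \<open>
  The two Grundy functions of a tame position differ at most by exchanging \<open>0\<close> and \<open>1\<close>,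
  which is invisible to the mex when both sets of option values contain \<open>{0, 1}\<close>.
\<close>

lemma sg_eq_misere_sg:
  assumes options: "\<And>y. (x, y) \<in> E \<Longrightarrow> tame_at y"
    and sg01: "{0, 1} \<subseteq> sg ` (E `` {x})"
    and misere01: "{0, 1} \<subseteq> misere_sg ` (E `` {x})"
  shows "sg x = misere_sg x"
proof -
  have "n \<in> sg ` (E `` {x}) \<longleftrightarrow> n \<in> misere_sg ` (E `` {x})" for n
  proof (cases "n = 0 \<or> n = 1")
    case True
    then show ?thesis using sg01 misere01 by auto
  next
    case False
    have "sg y = n \<longleftrightarrow> misere_sg y = n" if "(x, y) \<in> E" for y
      using options[OF that] by (cases rule: tame_at_cases) (use False in auto)
    then have "(\<exists>y. (x, y) \<in> E \<and> n = sg y) \<longleftrightarrow> (\<exists>y. (x, y) \<in> E \<and> n = misere_sg y)" by metis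
    then show ?thesis by (simp add: image_iff Bex_def)
  qed
  then have "sg ` (E `` {x}) = misere_sg ` (E `` {x})" by blast
  \<comment> \<open>An option is needed because the mex recursion for \<open>misere_sg\<close> holds
    only at nonterminal positions; terminal ones get the value 1.\<close>
  moreover obtain y where "(x, y) \<in> E" using sg01 by auto
  ultimately show ?thesis using misere_sg_nonterminal sg.simps[of x] by simp
qed

text \<open>Well-founded induction along the moves: the options of \<open>x\<close> are tame by
  hypothesis, so being movable to either pair of sets forces equal Grundy values at
  \<open>x\<close>.\<close>

lemma t_miserable_imp_tame_at:
  assumes "t_miserable"
  shows "x \<in> P \<Longrightarrow> tame_at x"
proof (induction x rule: wf_induct_rule[OF wf_converse_moves])
  case (1 x)
  have options: "tame_at y" if "(x, y) \<in> E" for y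
    using 1 that moves_in by auto
  \<comment> \<open>Treats both pairs at once: for (0,1) with (1,0), and for (0,0) with (1,1), the
    two options realise 0 and 1 under each Grundy function.\<close>
  have diagonal: "tame_at x"
    if "(x, y) \<in> E" "(x, z) \<in> E" "{sg y, sg z} = {0, 1}" "{misere_sg y, misere_sg z} = {0, 1}"
    for y z
  proof -
    have "{sg y, sg z} \<subseteq> sg ` (E `` {x})" "{misere_sg y, misere_sg z} \<subseteq> misere_sg ` (E `` {x})"
      using that by auto
    then have "sg x = misere_sg x"
      by (intro sg_eq_misere_sg options) (simp_all only: that)
    then show ?thesis using "1.prems" unfolding tame_at_def V_def by auto
  qed
  consider "x \<in> V 0 1 \<union> V 1 0 \<union> V 0 0 \<union> V 1 1"
    | "movable x (V 0 1)" "movable x (V 1 0)"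
    | "movable x (V 0 0)" "movable x (V 1 1)"
    using assms "1.prems" unfolding t_miserable_def by blast
  then show ?case
  proof cases
    case 1
    then show ?thesis unfolding tame_at_def by auto
  next
    case 2
    then obtain y z where "(x, y) \<in> E" "y \<in> V 0 1" "(x, z) \<in> E" "z \<in> V 1 0"
      unfolding movable_def by blast
    then show ?thesis using diagonal[of y z] by (auto simp: V_def)
  next
    case 3
    then obtain y z where "(x, y) \<in> E" "y \<in> V 0 0" "(x, z) \<in> E" "z \<in> V 1 1"
      unfolding movable_def by blast
    then show ?thesis using diagonal[of y z] by (auto simp: V_def)
  qed
qed

text \<open>As \<open>k\<close> is at least 2, each mex forces options of value 0 and of value 1;
  tameness confines these options to the four sets with indices 0 and 1.\<close>

lemma movable_of_diagonal:
  assumes options: "\<And>y. (x, y) \<in> E \<Longrightarrow> tame_at y"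
    and "sg x = k" "misere_sg x = k" "2 \<le> k"
  shows "movable x (V 0 1) \<and> movable x (V 1 0) \<or> movable x (V 0 0) \<and> movable x (V 1 1)"
proof -
  have sg_option: "\<exists>y. (x, y) \<in> E \<and> sg y = n" if "n < 2" for n
  proof -
    have "n < mex (sg ` (E `` {x}))" using assms that sg.simps[of x] by simp
    then show ?thesis by (auto dest: less_mex_imp_mem)
  qed
  have misere_option: "\<exists>y. (x, y) \<in> E \<and> misere_sg y = n" if "n < 2" for n
  proof -
    have "n < mex (misere_sg ` (E `` {x}))"
      \<comment> \<open>The option of normal value 0 shows that \<open>x\<close> is not terminal,
        which unlocks the mex recursion for \<open>misere_sg\<close>.\<close>
      using assms that misere_sg_nonterminal sg_option[of 0] by fastforce
    then show ?thesis by (auto dest: less_mex_imp_mem)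
  qed
  have movable_iff: "movable x (V i j) \<longleftrightarrow> (\<exists>y. (x, y) \<in> E \<and> sg y = i \<and> misere_sg y = j)" for i j
    unfolding movable_def using V_iff by blast
  \<comment> \<open>A tame option with normal value 0 has misere value 1 or 0, and one with normal
    value 1 has misere value 0 or 1. The next pair of facts exchanges the roles of the two
    functions.\<close>
  have "movable x (V 0 1) \<or> movable x (V 0 0)" "movable x (V 1 0) \<or> movable x (V 1 1)"
    unfolding movable_iff using sg_option[of 0] sg_option[of 1] options
    by (fastforce elim: tame_at_cases)+
  moreover have "movable x (V 1 0) \<or> movable x (V 0 0)" "movable x (V 0 1) \<or> movable x (V 1 1)"
    unfolding movable_iff using misere_option[of 0] misere_option[of 1] options
    by (fastforce elim: tame_at_cases)+
  \<comment> \<open>If \<open>V 0 1\<close> or \<open>V 1 0\<close> cannot be reached, the two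
    disjunctions containing it yield both \<open>V 0 0\<close> and \<open>V 1 1\<close>.\<close>
  ultimately show ?thesis by blast
qed

lemma tame_iff: "tame \<longleftrightarrow> (\<forall>x\<in>P. tame_at x)"
  unfolding tame_def tame_at_def ..

lemma tame_imp_t_miserable:
  assumes "tame"
  shows "t_miserable"
  unfolding t_miserable_def
proof
  fix x assume x: "x \<in> P"
  have options: "tame_at y" if "(x, y) \<in> E" for y
    using assms that moves_in unfolding tame_iff by auto
  show "x \<in> V 0 1 \<union> V 1 0 \<union> V 0 0 \<union> V 1 1 \<or>
     (movable x (V 0 1) \<and> movable x (V 1 0)) \<or> (movable x (V 0 0) \<and> movable x (V 1 1))"
  proof (cases "x \<in> V 0 1 \<union> V 1 0 \<union> V 0 0 \<union> V 1 1")
    case False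
    \<comment> \<open>Outside the four small sets, tameness leaves only equal values
      \<open>k\<close>, with 0 and 1 excluded.\<close>
    then obtain k where k: "x \<in> V k k"
      using assms x unfolding tame_def by auto
    with False have "k \<noteq> 0 \<and> k \<noteq> 1" by (metis UnCI)
    then show ?thesis
      using movable_of_diagonal[of x k] options k by (simp add: V_def)
  qed simp
qed

end

theorem theorem3p3:
  fixes P :: "'a set" and E :: "'a rel"
  assumes "game P E"
  shows "game.tame P E \<longleftrightarrow> game.t_miserable P E"
proof -
  interpret game P E by (rule assms)
  show ?thesis
    using t_miserable_imp_tame_at tame_imp_t_miserable tame_iff by blast
qed

end
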